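(* Let $\chi\in\psi$, let $f\in\mathcal{D}_b(\mathbb{R}^2_+)$ and suppose that $\theta_Bf$ is bounded on $\mathbb{R}^2_+$. Then for every $(x,y)\in\mathbb{R}^2_+$, every $w>0$ and all $\delta_1,\delta_2>0$, $$|\tilde I_w^{\chi}(f;x,y)-f(x,y)|\le E_1\big(3\|\theta_Bf\|_\infty+\omega_B(\theta_Bf;\delta_1,\delta_2)\big)+\left(\frac{E_2}{\delta_1}+\frac{E_3}{\delta_2}+\frac{E_4}{\delta_1\delta_2}\right)\omega_B(\theta_Bf;\delta_1,\delta_2),$$ where $$E_1=\frac{1}{4w^2}\left(M_{0,0}+2M_{1,0}+2M_{0,1}+4M_{1,1}\right),$$ $$E_2=\frac{1}{6w^3}\left(M_{0,0}+3M_{2,0}+3M_{1,0}+2M_{0,1}+6M_{2,1}+6M_{1,1}\right),$$ $$E_3=\frac{1}{6w^3}\left(M_{0,0}+3M_{0,2}+3M_{0,1}+2M_{1,0}+6M_{1,2}+6M_{1,1}\right),$$ $$E_4=\frac{1}{9w^4}\left(M_{0,0}+3M_{2,0}+3M_{0,2}+3M_{1,0}+3M_{0,1}+9M_{2,2}+9M_{1,2}+9M_{2,1}+9M_{1,1}\right).$$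
   Context: $\mathbb{R}_+=(0,\infty)$, $\mathbb{R}^2_+=\mathbb{R}_+\times\mathbb{R}_+$, $\|g\|_\infty=\sup_{\mathbb{R}^2_+}|g|$. $C(\mathbb{R}^2_+)$ is the space of continuous bounded functions on $\mathbb{R}^2_+$. Moments. For $\chi\in C(\mathbb{R}^2_+)$ and $p_1,p_2\in\mathbb{N}_0$, the absolute moments are $$M_{p_1,p_2}=M_{(p_1,p_2)}(\chi)=\sup_{(u,v)\in\mathbb{R}^2_+}\sum_{k\in\mathbb{Z}}\sum_{j\in\mathbb{Z}}|\chi(e^{-k}u,e^{-j}v)|\,|k-\log u|^{p_1}|j-\log v|^{p_2}\in[0,\infty],$$ with $M_\eta(\chi)=\max_{p_1+p_2=\eta}M_{(p_1,p_2)}(\chi)$ for $\eta\in\mathbb{N}_0$. (If a moment appearing in the estimate is infinite, the right-hand side is understood as $+\infty$.) Kernel class. $\psi$ is the class of real-valued $\chi\in C(\mathbb{R}^2_+)$ such that: (K1) $\sum_{k\in\mathbb{Z}}\sum_{j\in\mathbb{Z}}\chi(e^{-k}u,e^{-j}v)=1$ for every $(u,v)\in\mathbb{R}^2_+$; (K2) $M_2(\chi)<+\infty$ and, for all $p_1,p_2\in\mathbb{N}_0$ with $p_1+p_2=2$, $$\lim_{\gamma\to+\infty}\ \sum\sum_{(k,j)\notin B_\gamma(\log u,\log v)}|\chi(e^{-k}u,e^{-j}v)|\,|k-\log u|^{p_1}|j-\log v|^{p_2}=0$$ uniformly in $(u,v)\in\mathbb{R}^2_+$, where $(k,j)$ ranges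 over $\mathbb{Z}^2$ and $B_\gamma(a,b)$ is the open Euclidean disc of radius $\gamma$ centred at $(a,b)\in\mathbb{R}^2$. Operator. For $\chi\in\psi$ and $w>0$, the bivariate Kantorovich exponential sampling series of a locally integrable $g:\mathbb{R}^2_+\to\mathbb{R}$ is $$(I_w^{\chi}g)(x,y)=\sum_{k\in\mathbb{Z}}\sum_{j\in\mathbb{Z}}\chi(e^{-k}x^w,e^{-j}y^w)\,w^2\int_{k/w}^{(k+1)/w}\left(\int_{j/w}^{(j+1)/w}g(e^u,e^v)\,dv\right)du,$$ whenever this series converges. GBS operator. For $f:\mathbb{R}^2_+\to\mathbb{R}$ and $(x,y)\in\mathbb{R}^2_+$, $$\tilde I_w^{\chi}(f;x,y)=(I_w^{\chi}g_{x,y})(x,y),\qquad g_{x,y}(s,t)=f(x,t)+f(s,y)-f(s,t),$$ where it is understood that $g_{x,y}$ is locally integrable and the defining series converges. Mellin B-differentiability. For $f:\mathbb{R}^2_+\to\mathbb{R}$ and $(s,t),(x,y)\in\mathbb{R}^2_+$ put $$\Delta_{(x,y)}f[s,t;x,y]=f(x,y)-f(x,t)-f(s,y)+f(s,t).$$ $f$ is Mellin $B$-differentiable at $(s,t)$ if the limit $$\theta_Bf(s,t)=\lim_{(x,y)\to(s,t)}\frac{\Delta_{(x,y)}f[s,t;x,y]}{(\log s-\log x)(\log t-\log y)}$$ (over $(x,y)$ with $x\ne s$, $y\ne t$) exists and is finite; $\theta_Bf$ is the Mellin $B$-differential of $f$. $\mathcal{D}_b(\mathbb{R}^2_+)$ is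 the space of functions $f:\mathbb{R}^2_+\to\mathbb{R}$ that are Mellin $B$-differentiable at every point of $\mathbb{R}^2_+$. Mixed modulus of smoothness: for $g:\mathbb{R}^2_+\to\mathbb{R}$ and $\delta_1,\delta_2>0$, $$\omega_B(g;\delta_1,\delta_2)=\sup\{|\Delta_{(x,y)}g[s,t;x,y]|:\ (x,y),(s,t)\in\mathbb{R}^2_+,\ |\log s-\log x|<\delta_1,\ |\log t-\log y|<\delta_2\}.$$ *)

theory Defs
  imports "HOL-Analysis.Analysis"
begin

(* The kernel chi is written \<kappa>, since \<chi> is a binder in HOL-Analysis.
   Functions on the open quadrant are total functions on real * real; their values outside
   the quadrant are never used. Double series over Z^2 are unordered sums over int * int. *)

definition quadrant :: "(real \<times> real) set" where
  "quadrant = {0<..} \<times> {0<..}"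

definition sup_norm :: "(real \<times> real \<Rightarrow> real) \<Rightarrow> ennreal" where
  "sup_norm g = (SUP p\<in>quadrant. ennreal \<bar>g p\<bar>)"

definition moment_term ::
  "(real \<times> real \<Rightarrow> real) \<Rightarrow> nat \<Rightarrow> nat \<Rightarrow> real \<times> real \<Rightarrow> int \<times> int \<Rightarrow> real" where
  "moment_term \<kappa> p1 p2 = (\<lambda>(u, v) (k, j).
     \<bar>\<kappa> (exp (- real_of_int k) * u, exp (- real_of_int j) * v)\<bar>
       * \<bar>real_of_int k - ln u\<bar> ^ p1 * \<bar>real_of_int j - ln v\<bar> ^ p2)"

definition abs_moment :: "(real \<times> real \<Rightarrow> real) \<Rightarrow> nat \<Rightarrow> nat \<Rightarrow> ennreal" where
  "abs_moment \<kappa> p1 p2 =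
     (SUP p\<in>quadrant. \<Sum>\<^sub>\<infinity>kj\<in>UNIV. ennreal (moment_term \<kappa> p1 p2 p kj))"

definition abs_moment_order :: "(real \<times> real \<Rightarrow> real) \<Rightarrow> nat \<Rightarrow> ennreal" where
  "abs_moment_order \<kappa> n = Max {abs_moment \<kappa> p1 p2 |p1 p2. p1 + p2 = n}"

(* In the last condition the real-valued tail sums exist because abs_moment_order \<kappa> 2 is finite.
   Boundedness of \<kappa> together with that finiteness also makes the series in the partition of
   unity absolutely convergent, so the order of summation there does not matter.
   The metric on real * real is the Euclidean one, so ball is the open Euclidean disc. *)
definition kernel_class :: "(real \<times> real \<Rightarrow> real) set" where
  "kernel_class = {\<kappa>.
     continuous_on quadrant \<kappa> \<and> bounded (\<kappa> ` quadrant) \<and>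
     (\<forall>(u, v)\<in>quadrant.
        ((\<lambda>(k, j). \<kappa> (exp (- real_of_int k) * u, exp (- real_of_int j) * v)) has_sum 1) UNIV) \<and>
     abs_moment_order \<kappa> 2 < \<infinity> \<and>
     (\<forall>p1 p2. p1 + p2 = 2 \<longrightarrow>
        uniform_limit quadrant
          (\<lambda>\<gamma> (u, v). \<Sum>\<^sub>\<infinity>kj\<in>{(k, j). (real_of_int k, real_of_int j) \<notin> ball (ln u, ln v) \<gamma>}.
             moment_term \<kappa> p1 p2 (u, v) kj)
          (\<lambda>_. 0) at_top)}"

definition locally_integrable :: "(real \<times> real \<Rightarrow> real) \<Rightarrow> bool" where
  "locally_integrable g \<longleftrightarrow>
     (\<forall>K. compact K \<and> K \<subseteq> quadrant \<longrightarrow> set_integrable lebesgue K g)"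

definition kantorovich_term ::
  "(real \<times> real \<Rightarrow> real) \<Rightarrow> real \<Rightarrow> (real \<times> real \<Rightarrow> real) \<Rightarrow> real \<times> real \<Rightarrow> int \<times> int \<Rightarrow> real" where
  "kantorovich_term \<kappa> w g = (\<lambda>(x, y) (k, j).
     \<kappa> (exp (- real_of_int k) * x powr w, exp (- real_of_int j) * y powr w) * w\<^sup>2 *
     (LINT u:{real_of_int k / w .. (real_of_int k + 1) / w}|lebesgue.
       (LINT v:{real_of_int j / w .. (real_of_int j + 1) / w}|lebesgue. g (exp u, exp v))))"

(* The value is meaningful only when kantorovich_defined holds. *)
definition kantorovich ::
  "(real \<times> real \<Rightarrow> real) \<Rightarrow> real \<Rightarrow> (real \<times> real \<Rightarrow> real) \<Rightarrow> real \<times> real \<Rightarrow> real" where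
  "kantorovich \<kappa> w g p = (\<Sum>\<^sub>\<infinity>kj\<in>UNIV. kantorovich_term \<kappa> w g p kj)"

definition kantorovich_defined ::
  "(real \<times> real \<Rightarrow> real) \<Rightarrow> real \<Rightarrow> (real \<times> real \<Rightarrow> real) \<Rightarrow> real \<times> real \<Rightarrow> bool" where
  "kantorovich_defined \<kappa> w g p \<longleftrightarrow>
     locally_integrable g \<and> kantorovich_term \<kappa> w g p summable_on UNIV"

definition gbs_argument :: "(real \<times> real \<Rightarrow> real) \<Rightarrow> real \<times> real \<Rightarrow> real \<times> real \<Rightarrow> real" where
  "gbs_argument f = (\<lambda>(x, y) (s, t). f (x, t) + f (s, y) - f (s, t))"

definition gbs ::
  "(real \<times> real \<Rightarrow> real) \<Rightarrow> real \<Rightarrow> (real \<times> real \<Rightarrow> real) \<Rightarrow> real \<times> real \<Rightarrow> real" where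
  "gbs \<kappa> w f p = kantorovich \<kappa> w (gbs_argument f p) p"

definition gbs_defined ::
  "(real \<times> real \<Rightarrow> real) \<Rightarrow> real \<Rightarrow> (real \<times> real \<Rightarrow> real) \<Rightarrow> real \<times> real \<Rightarrow> bool" where
  "gbs_defined \<kappa> w f p \<longleftrightarrow> kantorovich_defined \<kappa> w (gbs_argument f p) p"

definition mixed_diff :: "(real \<times> real \<Rightarrow> real) \<Rightarrow> real \<times> real \<Rightarrow> real \<times> real \<Rightarrow> real" where
  "mixed_diff f = (\<lambda>(s, t) (x, y). f (x, y) - f (x, t) - f (s, y) + f (s, t))"

definition mellin_B_quotient ::
  "(real \<times> real \<Rightarrow> real) \<Rightarrow> real \<times> real \<Rightarrow> real \<times> real \<Rightarrow> real" where
  "mellin_B_quotient f = (\<lambda>(s, t) (x, y).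
     mixed_diff f (s, t) (x, y) / ((ln s - ln x) * (ln t - ln y)))"

definition mellin_B_filter :: "real \<times> real \<Rightarrow> (real \<times> real) filter" where
  "mellin_B_filter = (\<lambda>(s, t). at (s, t) within {(x, y)\<in>quadrant. x \<noteq> s \<and> y \<noteq> t})"

definition mellin_B_differentiable :: "(real \<times> real \<Rightarrow> real) \<Rightarrow> real \<times> real \<Rightarrow> bool" where
  "mellin_B_differentiable f p \<longleftrightarrow>
     (\<exists>L. (mellin_B_quotient f p \<longlongrightarrow> L) (mellin_B_filter p))"

definition mellin_B_differential :: "(real \<times> real \<Rightarrow> real) \<Rightarrow> real \<times> real \<Rightarrow> real" where
  "mellin_B_differential f p = Lim (mellin_B_filter p) (mellin_B_quotient f p)"

definition mellin_B_space :: "(real \<times> real \<Rightarrow> real) set" where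
  "mellin_B_space = {f. \<forall>p\<in>quadrant. mellin_B_differentiable f p}"

definition mixed_modulus :: "(real \<times> real \<Rightarrow> real) \<Rightarrow> real \<Rightarrow> real \<Rightarrow> ennreal" where
  "mixed_modulus g \<delta>1 \<delta>2 =
     Sup {ennreal \<bar>mixed_diff g (s, t) (x, y)\<bar> |x y s t.
       (x, y) \<in> quadrant \<and> (s, t) \<in> quadrant \<and>
       \<bar>ln s - ln x\<bar> < \<delta>1 \<and> \<bar>ln t - ln y\<bar> < \<delta>2}"

end

theory Submission imports Defs begin

text \<open>
  The error is governed by a mean value inequality for mixed differences. Write
  \<open>\<theta>\<close> for the Mellin \<open>B\<close>-differential of \<open>f\<close> and \<open>N\<close> for its supremum norm. In logarithmic
  coordinates \<open>\<theta>\<close> is the density of the additive rectangle function given by the mixed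
  differences of \<open>f\<close>, so the mixed difference over any rectangle is at most \<open>N\<close> times the
  logarithmic area (\<open>mixed_diff_mean_value_bound\<close>). This is shown by subdividing rectangles
  until the local estimate coming from the limit that defines \<open>\<theta>\<close> applies.

  The integrand of the operator is \<open>f (x, y)\<close> minus the mixed difference
  \<open>G u v\<close> of \<open>f\<close> between the corners \<open>(exp u, exp v)\<close> and \<open>(x, y)\<close>. A mixed difference of \<open>G\<close>
  is again one of \<open>f\<close>, and \<open>G\<close> vanishes on the lines \<open>u = ln x\<close> and \<open>v = ln y\<close>; hence \<open>G\<close>
  is Lipschitz in each variable, all integrals are integrals of continuous functions, and
  the mean of \<open>G\<close> over a cell of side \<open>1 / w\<close> is bounded by a product of two one-dimensional
  means (\<open>iterated_integral_mixed_lipschitz\<close>). That product is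
  \<open>N / (4 * w^2) * (1 + 2 * X) * (1 + 2 * Y)\<close> with \<open>X\<close> and \<open>Y\<close> the factors
  \<open>\<bar>k - w * ln x\<bar>\<close>, \<open>\<bar>j - w * ln y\<bar>\<close> of the moments. The kernel sums to \<open>1\<close>, so summation
  against it gives that the error is at most \<open>E1 * N\<close>
  (\<open>gbs_error_le_moments_mult_sup_norm\<close>).

  The classical estimate writes the intermediate value of \<open>\<theta>\<close> at \<open>(\<xi>, \<eta>)\<close> as
  \<open>\<theta> (x, \<eta>) + \<theta> (\<xi>, y) - \<theta> (x, y)\<close> plus a mixed difference of \<open>\<theta>\<close>, which produces
  \<open>3 * N\<close> and the modulus \<open>\<omega>\<close>. Bounding the intermediate value by \<open>N\<close> itself is sharper:
  \<open>E1 * N\<close> is at most \<open>E1 * (3 * N + \<omega>)\<close>, and the terms with \<open>E2\<close>, \<open>E3\<close>, \<open>E4\<close> are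
  nonnegative.
\<close>

section \<open>The Mellin differential as a limit\<close>

text \<open>Nontriviality of the filter is what makes limits along it unique, so that the
  value chosen in the definition of the differential is the limit of the quotients.\<close>

lemma mellin_B_filter_neq_bot:
  assumes "p \<in> quadrant"
  shows "mellin_B_filter p \<noteq> bot"
proof -
  obtain s t where p: "p = (s, t)" "s > 0" "t > 0"
    using assms by (cases p) (auto simp: quadrant_def)
  have "((\<lambda>n. (s + 1 / real (Suc n), t + 1 / real (Suc n))) \<longlongrightarrow> (s + 0, t + 0)) sequentially"
    by (intro tendsto_intros LIMSEQ_inverse_real_of_nat[unfolded inverse_eq_divide])
  then have "(s, t) islimpt {(x, y) \<in> quadrant. x \<noteq> s \<and> y \<noteq> t}"
    unfolding islimpt_sequential using p
    by (intro exI[of _ "\<lambda>n. (s + 1 / real (Suc n), t + 1 / real (Suc n))"])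
       (auto simp: quadrant_def add_pos_pos)
  then show ?thesis
    by (simp add: mellin_B_filter_def p(1) trivial_limit_within)
qed

lemma mellin_B_quotient_tendsto:
  assumes "f \<in> mellin_B_space" "p \<in> quadrant"
  shows "(mellin_B_quotient f p \<longlongrightarrow> mellin_B_differential f p) (mellin_B_filter p)"
proof -
  obtain L where L: "(mellin_B_quotient f p \<longlongrightarrow> L) (mellin_B_filter p)"
    using assms by (auto simp: mellin_B_space_def mellin_B_differentiable_def)
  then have "mellin_B_differential f p = L"
    unfolding mellin_B_differential_def
    by (intro tendsto_Lim mellin_B_filter_neq_bot assms(2))
  then show ?thesis using L by simp
qed

section \<open>The mean value inequality for mixed differences\<close>

text \<open>On the lines \<open>x = s\<close> and \<open>y = t\<close>, which the limit excludes, the mixed difference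
  vanishes; everywhere else nearby the quotient is below \<open>K\<close> in absolute value.\<close>

lemma mixed_diff_corner_bound:
  assumes f: "f \<in> mellin_B_space" and pos: "s > 0" "t > 0"
    and K: "\<bar>mellin_B_differential f (s, t)\<bar> < K"
  obtains d where "d > 0"
    "\<And>x y. x > 0 \<Longrightarrow> y > 0 \<Longrightarrow> \<bar>x - s\<bar> < d \<Longrightarrow> \<bar>y - t\<bar> < d \<Longrightarrow>
       \<bar>mixed_diff f (s, t) (x, y)\<bar> \<le> K * \<bar>ln x - ln s\<bar> * \<bar>ln y - ln t\<bar>"
proof -
  have "((\<lambda>q. \<bar>mellin_B_quotient f (s, t) q\<bar>) \<longlongrightarrow> \<bar>mellin_B_differential f (s, t)\<bar>)
      (mellin_B_filter (s, t))"
    by (intro tendsto_intros mellin_B_quotient_tendsto f) (simp add: quadrant_def pos)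
  then have "eventually (\<lambda>q. \<bar>mellin_B_quotient f (s, t) q\<bar> < K) (mellin_B_filter (s, t))"
    using K by (rule order_tendstoD)
  then obtain e where "e > 0" and e:
    "\<forall>q\<in>{(x, y) \<in> quadrant. x \<noteq> s \<and> y \<noteq> t}.
       q \<noteq> (s, t) \<and> dist q (s, t) < e \<longrightarrow> \<bar>mellin_B_quotient f (s, t) q\<bar> < K"
    unfolding mellin_B_filter_def prod.case eventually_at by blast
  show ?thesis
  proof (rule that[of "e / 2"])
    show "e / 2 > 0" using \<open>e > 0\<close> by simp
    fix x y :: real
    assume xy: "x > 0" "y > 0" and near: "\<bar>x - s\<bar> < e / 2" "\<bar>y - t\<bar> < e / 2"
    show "\<bar>mixed_diff f (s, t) (x, y)\<bar> \<le> K * \<bar>ln x - ln s\<bar> * \<bar>ln y - ln t\<bar>"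
    proof (cases "x = s \<or> y = t")
      case True
      then show ?thesis by (auto simp: mixed_diff_def)
    next
      case False
      have "dist (x, y) (s, t) \<le> \<bar>x - s\<bar> + \<bar>y - t\<bar>"
        unfolding dist_Pair_Pair dist_real_def by (rule sqrt_sum_squares_le_sum_abs[THEN order_trans]) simp
      then have "\<bar>mellin_B_quotient f (s, t) (x, y)\<bar> < K"
        using e[rule_format, of "(x, y)"] xy near False by (simp add: quadrant_def)
      moreover have "\<bar>ln s - ln x\<bar> * \<bar>ln t - ln y\<bar> > 0"
        using False pos xy by auto
      ultimately show ?thesis
        by (simp add: mellin_B_quotient_def abs_mult pos_divide_less_eq abs_minus_commute mult.assoc)
    qed
  qed
qed

text \<open>The differential at \<open>(s, t)\<close> only controls rectangles with a corner at \<open>(s, t)\<close>. A rectangle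
  that contains \<open>(s, t)\<close> is cut there into four such rectangles; both the mixed difference and
  the logarithmic area are additive.\<close>

lemma mixed_diff_small_rectangle:
  assumes f: "f \<in> mellin_B_space" and pos: "s > 0" "t > 0"
    and K: "\<bar>mellin_B_differential f (s, t)\<bar> < K"
  obtains d where "d > 0"
    "\<And>a b a' b'. 0 < a \<Longrightarrow> a \<le> s \<Longrightarrow> s \<le> b \<Longrightarrow> b - a < d \<Longrightarrow>
       0 < a' \<Longrightarrow> a' \<le> t \<Longrightarrow> t \<le> b' \<Longrightarrow> b' - a' < d \<Longrightarrow>
       \<bar>mixed_diff f (a, a') (b, b')\<bar> \<le> K * (ln b - ln a) * (ln b' - ln a')"
proof -
  obtain d where "d > 0" and d:
    "\<And>x y. x > 0 \<Longrightarrow> y > 0 \<Longrightarrow> \<bar>x - s\<bar> < d \<Longrightarrow> \<bar>y - t\<bar> < d \<Longrightarrow>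
       \<bar>mixed_diff f (s, t) (x, y)\<bar> \<le> K * \<bar>ln x - ln s\<bar> * \<bar>ln y - ln t\<bar>"
    using mixed_diff_corner_bound[OF assms] by metis
  show ?thesis
  proof (rule that[OF \<open>d > 0\<close>])
    fix a b a' b' :: real
    assume ab: "0 < a" "a \<le> s" "s \<le> b" "b - a < d"
      and ab': "0 < a'" "a' \<le> t" "t \<le> b'" "b' - a' < d"
    define \<Delta> where "\<Delta> = mixed_diff f (s, t)"
    have ln: "ln a \<le> ln s" "ln s \<le> ln b" "ln a' \<le> ln t" "ln t \<le> ln b'"
      using ab ab' pos by auto
    have split: "mixed_diff f (a, a') (b, b') = \<Delta> (b, b') - \<Delta> (a, b') - \<Delta> (b, a') + \<Delta> (a, a')"
      by (simp add: \<Delta>_def mixed_diff_def)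
    have "\<bar>\<Delta> (b, b')\<bar> \<le> K * (ln b - ln s) * (ln b' - ln t)"
      "\<bar>\<Delta> (a, b')\<bar> \<le> K * (ln s - ln a) * (ln b' - ln t)"
      "\<bar>\<Delta> (b, a')\<bar> \<le> K * (ln b - ln s) * (ln t - ln a')"
      "\<bar>\<Delta> (a, a')\<bar> \<le> K * (ln s - ln a) * (ln t - ln a')"
      using d[of b b'] d[of a b'] d[of b a'] d[of a a'] ab ab' pos ln
      unfolding \<Delta>_def by auto
    then have "\<bar>mixed_diff f (a, a') (b, b')\<bar> \<le> K * (ln b - ln s) * (ln b' - ln t)
        + K * (ln s - ln a) * (ln b' - ln t) + K * (ln b - ln s) * (ln t - ln a')
        + K * (ln s - ln a) * (ln t - ln a')"
      unfolding split by linarith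
    also have "\<dots> = K * (ln b - ln a) * (ln b' - ln a')"
      by (simp add: algebra_simps)
    finally show "\<bar>mixed_diff f (a, a') (b, b')\<bar> \<le> K * (ln b - ln a) * (ln b' - ln a')" .
  qed
qed

text \<open>The bound passes from two adjacent rectangles to their union and holds for all small
  rectangles around a given point. Bisection is applied to each coordinate in turn: bisecting
  the second coordinate turns the local bound at every point of a vertical segment into one
  for narrow strips around the whole segment, and bisecting the first coordinate glues strips
  together.\<close>

lemma mixed_diff_ordered_rectangle_bound:
  assumes f: "f \<in> mellin_B_space"
    and K: "\<And>p. p \<in> quadrant \<Longrightarrow> \<bar>mellin_B_differential f p\<bar> < K"
    and ab: "0 < a" "a \<le> b" and ab': "0 < a'" "a' \<le> b'"
  shows "\<bar>mixed_diff f (a, a') (b, b')\<bar> \<le> K * (ln b - ln a) * (ln b' - ln a')"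
proof -
  define P where "P a b a' b' \<longleftrightarrow>
    \<bar>mixed_diff f (a, a') (b, b')\<bar> \<le> K * (ln b - ln a) * (ln b' - ln a')" for a b a' b'
  have glue1: "P a c a' b'" if "P a b a' b'" "P b c a' b'" for a b c a' b'
  proof -
    have "mixed_diff f (a, a') (c, b') = mixed_diff f (a, a') (b, b') + mixed_diff f (b, a') (c, b')"
      by (simp add: mixed_diff_def)
    moreover have "K * (ln c - ln a) * (ln b' - ln a')
        = K * (ln b - ln a) * (ln b' - ln a') + K * (ln c - ln b) * (ln b' - ln a')"
      by (simp add: algebra_simps)
    ultimately show ?thesis using that unfolding P_def by linarith
  qed
  have glue2: "P a b a' c'" if "P a b a' b'" "P a b b' c'" for a b a' b' c'
  proof -
    have "mixed_diff f (a, a') (b, c') = mixed_diff f (a, a') (b, b') + mixed_diff f (a, b') (b, c')"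
      by (simp add: mixed_diff_def)
    moreover have "K * (ln b - ln a) * (ln c' - ln a')
        = K * (ln b - ln a) * (ln b' - ln a') + K * (ln b - ln a) * (ln c' - ln b')"
      by (simp add: algebra_simps)
    ultimately show ?thesis using that unfolding P_def by linarith
  qed
  define Q where "Q s d u v \<longleftrightarrow>
    (\<forall>a b. 0 < a \<and> a \<le> s \<and> s \<le> b \<and> b - a < d \<longrightarrow> P a b u v)" for s d u v
  \<comment> \<open>The width \<open>d\<close> of the strip has to be quantified inside the bisected property, since each
    of the pieces of \<open>{a'..b'}\<close> comes with its own width; gluing takes the minimum.\<close>
  have strip: "\<exists>d>0. Q s d a' b'" if "s > 0" for s
  proof -
    have "0 < a' \<longrightarrow> (\<exists>d>0. Q s d a' b')"
      using ab'(2)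
    proof (induction rule: Bolzano)
      case (trans u v z)
      show ?case
      proof
        assume "0 < u"
        then have "0 < v" using trans by linarith
        then obtain d e where "d > 0" "e > 0" and Q: "Q s d u v" "Q s e v z"
          using trans.IH \<open>0 < u\<close> by blast
        have "Q s (min d e) u z"
          using Q glue2 unfolding Q_def by (metis min_less_iff_conj)
        then show "\<exists>d>0. Q s d u z"
          using \<open>d > 0\<close> \<open>e > 0\<close> by (intro exI[of _ "min d e"]) simp
      qed
    next
      case (local t)
      then have "t > 0" using ab'(1) by simp
      have "\<bar>mellin_B_differential f (s, t)\<bar> < K"
        using \<open>s > 0\<close> \<open>t > 0\<close> by (intro K) (simp add: quadrant_def)
      then obtain d where "d > 0" and d: "\<And>a b a' b'. 0 < a \<Longrightarrow> a \<le> s \<Longrightarrow> s \<le> b \<Longrightarrow> b - a < d \<Longrightarrow>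
          0 < a' \<Longrightarrow> a' \<le> t \<Longrightarrow> t \<le> b' \<Longrightarrow> b' - a' < d \<Longrightarrow> P a b a' b'"
        unfolding P_def using mixed_diff_small_rectangle[OF f \<open>s > 0\<close> \<open>t > 0\<close>] by metis
      then have "Q s d u v" if "u \<le> t" "t \<le> v" "v - u < d" "0 < u" for u v
        using that unfolding Q_def by blast
      then show ?case using \<open>d > 0\<close> by blast
    qed
    then show ?thesis using ab'(1) by simp
  qed
  have "0 < a \<longrightarrow> P a b a' b'"
    using ab(2)
  proof (induction rule: Bolzano)
    case (trans u v z)
    then show ?case using glue1 by auto
  next
    case (local s)
    then have "s > 0" using ab(1) by simp
    then obtain d where "d > 0" "Q s d a' b'" using strip by blast
    then show ?case unfolding Q_def by blast
  qed
  then show ?thesis using ab(1) by (simp add: P_def)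
qed

lemma mixed_diff_mean_value_bound:
  assumes f: "f \<in> mellin_B_space"
    and K: "\<And>p. p \<in> quadrant \<Longrightarrow> \<bar>mellin_B_differential f p\<bar> \<le> K"
    and pos: "s > 0" "t > 0" "x > 0" "y > 0"
  shows "\<bar>mixed_diff f (s, t) (x, y)\<bar> \<le> K * \<bar>ln s - ln x\<bar> * \<bar>ln t - ln y\<bar>"
proof -
  \<comment> \<open>The rectangle bound needs a strict bound on the differential, so \<open>K\<close> is enlarged by
    \<open>e\<close> and \<open>e\<close> tends to \<open>0\<close>.\<close>
  define A where "A = \<bar>ln s - ln x\<bar> * \<bar>ln t - ln y\<bar>"
  have "\<bar>mixed_diff f (s, t) (x, y)\<bar> \<le> (K + e) * A" if "e > 0" for e
  proof -
    have "\<bar>mixed_diff f (min s x, min t y) (max s x, max t y)\<bar>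
        \<le> (K + e) * (ln (max s x) - ln (min s x)) * (ln (max t y) - ln (min t y))"
    proof (rule mixed_diff_ordered_rectangle_bound[OF f])
      show "\<bar>mellin_B_differential f p\<bar> < K + e" if "p \<in> quadrant" for p
        using K[OF that] \<open>e > 0\<close> by linarith
    qed (use pos in auto)
    moreover have "\<bar>mixed_diff f (min s x, min t y) (max s x, max t y)\<bar>
        = \<bar>mixed_diff f (s, t) (x, y)\<bar>"
      by (auto simp: mixed_diff_def min_def max_def)
    moreover have "ln (max s x) - ln (min s x) = \<bar>ln s - ln x\<bar>"
      "ln (max t y) - ln (min t y) = \<bar>ln t - ln y\<bar>"
      using pos by (auto simp: min_def max_def)
    ultimately show ?thesis by (simp add: A_def mult.assoc)
  qed
  then have "eventually (\<lambda>e. \<bar>mixed_diff f (s, t) (x, y)\<bar> \<le> (K + e) * A) (at_right 0)"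
    by (simp add: eventually_at_filter)
  moreover have "((\<lambda>e. (K + e) * A) \<longlongrightarrow> (K + 0) * A) (at_right 0)"
    by (intro tendsto_intros)
  ultimately have "\<bar>mixed_diff f (s, t) (x, y)\<bar> \<le> (K + 0) * A"
    by (intro tendsto_lowerbound) auto
  then show ?thesis by (simp add: A_def mult.assoc)
qed

section \<open>Integrals over a cell\<close>

lemma lebesgue_integral_eq_integral_continuous:
  fixes g :: "real \<Rightarrow> real"
  assumes "continuous_on {a..b} g"
  shows "(LINT u:{a..b}|lebesgue. g u) = integral {a..b} g"
  by (intro set_lebesgue_integral_eq_integral(2) absolutely_integrable_continuous_real assms)

text \<open>The triangle inequality through the left endpoint \<open>a\<close>. Over a cell of length \<open>1 / w\<close> the right-hand
  side becomes a multiple of \<open>1 + 2 * \<bar>k - w * \<alpha>\<bar>\<close>, which is where the weights of the moments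
  in the final estimate come from.\<close>

lemma integral_abs_diff_le:
  fixes a h \<alpha> :: real
  assumes "h > 0"
  shows "integral {a..a + h} (\<lambda>u. \<bar>u - \<alpha>\<bar>) \<le> h * \<bar>a - \<alpha>\<bar> + h\<^sup>2 / 2"
proof -
  have "((\<lambda>u. \<bar>a - \<alpha>\<bar> + (u - a)) has_integral
      (\<bar>a - \<alpha>\<bar> * (a + h) + (a + h - a)\<^sup>2 / 2) - (\<bar>a - \<alpha>\<bar> * a + (a - a)\<^sup>2 / 2)) {a..a + h}"
    using assms
    by (intro fundamental_theorem_of_calculus)
       (auto intro!: derivative_eq_intros simp flip: has_real_derivative_iff_has_vector_derivative)
  then have "((\<lambda>u. \<bar>a - \<alpha>\<bar> + (u - a)) has_integral h * \<bar>a - \<alpha>\<bar> + h\<^sup>2 / 2) {a..a + h}"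
    by (simp add: algebra_simps)
  moreover have "((\<lambda>u. \<bar>u - \<alpha>\<bar>) has_integral integral {a..a + h} (\<lambda>u. \<bar>u - \<alpha>\<bar>)) {a..a + h}"
    by (intro integrable_integral integrable_continuous_interval continuous_intros)
  ultimately show ?thesis
    by (rule_tac has_integral_le) auto
qed

text \<open>A function that is Lipschitz for mixed differences and vanishes on two crossing lines is
  Lipschitz in each variable separately: compare with the values on the lines. The inner
  integral inherits this, so both integrals exist, and the size of \<open>G\<close> is bounded by the
  product \<open>K * \<bar>u - \<alpha>\<bar> * \<bar>v - \<beta>\<bar>\<close>, which can be integrated factor by factor.\<close>

lemma iterated_integral_mixed_lipschitz:
  fixes G :: "real \<Rightarrow> real \<Rightarrow> real"
  assumes zero: "\<And>v. G \<alpha> v = 0" "\<And>u. G u \<beta> = 0"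
    and lip: "\<And>u v u' v'. \<bar>G u v - G u' v - G u v' + G u' v'\<bar> \<le> K * \<bar>u - u'\<bar> * \<bar>v - v'\<bar>"
    and h: "h > 0"
  shows "\<bar>(LINT u:{a..a + h}|lebesgue. (LINT v:{b..b + h}|lebesgue. C - G u v)) - h\<^sup>2 * C\<bar>
    \<le> K * (h * \<bar>a - \<alpha>\<bar> + h\<^sup>2 / 2) * (h * \<bar>b - \<beta>\<bar> + h\<^sup>2 / 2)"
proof -
  have K: "K \<ge> 0" using lip[of 1 1 0 0] by simp
  have lip1: "\<bar>G u v - G u' v\<bar> \<le> K * \<bar>u - u'\<bar> * \<bar>v - \<beta>\<bar>" for u u' v
    using lip[of u v u' \<beta>] by (simp add: zero)
  have lip2: "\<bar>G u v - G u v'\<bar> \<le> K * \<bar>u - \<alpha>\<bar> * \<bar>v - v'\<bar>" for u v v'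
    using lip[of u v \<alpha> v'] by (simp add: zero)
  define B where "B = integral {b..b + h} (\<lambda>v. \<bar>v - \<beta>\<bar>)"
  define H where "H u = integral {b..b + h} (G u)" for u
  have lipschitz_cont: "continuous_on S g" if "\<And>p q. \<bar>g p - g q\<bar> \<le> L * \<bar>p - q\<bar>"
    for g :: "real \<Rightarrow> real" and L S
  proof (rule lipschitz_on_continuous_on[where L = "\<bar>L\<bar>"], rule lipschitz_onI)
    show "dist (g p) (g q) \<le> \<bar>L\<bar> * dist p q" for p q
      using order_trans[OF that mult_right_mono[OF abs_ge_self abs_ge_zero]] by (simp add: dist_real_def)
  qed simp
  have contG: "continuous_on S (G u)" for u S
    by (rule lipschitz_cont[where L = "K * \<bar>u - \<alpha>\<bar>"]) (rule lip2)
  have intG: "G u integrable_on {b..b + h}" for u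
    by (rule integrable_continuous_interval[OF contG])
  have intB: "(\<lambda>v. L * \<bar>v - \<beta>\<bar>) integrable_on {b..b + h}" for L
    by (intro integrable_continuous_interval continuous_intros)
  have H_lip: "\<bar>H u - H u'\<bar> \<le> (K * B) * \<bar>u - u'\<bar>" for u u'
  proof -
    have "\<bar>H u - H u'\<bar> = norm (integral {b..b + h} (\<lambda>v. G u v - G u' v))"
      by (simp add: H_def integral_diff intG)
    also have "\<dots> \<le> integral {b..b + h} (\<lambda>v. (K * \<bar>u - u'\<bar>) * \<bar>v - \<beta>\<bar>)"
      using lip1 by (intro integral_norm_bound_integral integrable_diff intG intB) auto
    also have "\<dots> = (K * B) * \<bar>u - u'\<bar>"
      unfolding B_def by (subst integral_mult_right) simp
    finally show ?thesis .
  qed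
  have contH: "continuous_on S H" for S
    by (rule lipschitz_cont) (rule H_lip)
  have inner: "(LINT v:{b..b + h}|lebesgue. C - G u v) = h * C - H u" for u
    using h by (subst lebesgue_integral_eq_integral_continuous)
      (auto intro!: continuous_intros contG simp: integral_diff[OF integrable_const_ivl intG] H_def)
  have outer: "(LINT u:{a..a + h}|lebesgue. h * C - H u) = h\<^sup>2 * C - integral {a..a + h} H"
    using h by (subst lebesgue_integral_eq_integral_continuous)
      (auto intro!: continuous_intros contH simp: power2_eq_square
        integral_diff[OF integrable_const_ivl integrable_continuous_interval[OF contH]])
  have "G \<alpha> = (\<lambda>_. 0)" using zero(1) by auto
  then have "H \<alpha> = 0" by (simp add: H_def)
  then have H_bound: "\<bar>H u\<bar> \<le> (K * B) * \<bar>u - \<alpha>\<bar>" for u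
    using H_lip[of u \<alpha>] by simp
  have B0: "B \<ge> 0" unfolding B_def by (rule integral_nonneg) (use intB[of 1] in auto)
  have "norm (integral {a..a + h} H) \<le> integral {a..a + h} (\<lambda>u. (K * B) * \<bar>u - \<alpha>\<bar>)"
    using H_bound
    by (intro integral_norm_bound_integral integrable_continuous_interval contH continuous_intros) auto
  also have "\<dots> = K * integral {a..a + h} (\<lambda>u. \<bar>u - \<alpha>\<bar>) * B"
    by simp
  also have "\<dots> \<le> K * (h * \<bar>a - \<alpha>\<bar> + h\<^sup>2 / 2) * (h * \<bar>b - \<beta>\<bar> + h\<^sup>2 / 2)"
    using K B0 h integral_abs_diff_le[OF h] unfolding B_def
    by (intro mult_mono[OF mult_left_mono]) auto
  finally show ?thesis
    by (simp add: inner outer)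
qed

section \<open>Summation against the kernel\<close>

text \<open>Both the error series and the moments, as elements of \<open>[0, \<infinity>]\<close>, are compared through
  finite partial sums. If the series diverges, the left-hand side is \<open>0\<close> by the default value
  of the sum.\<close>

lemma ennreal_abs_infsum_le:
  fixes h :: "'a \<Rightarrow> real"
  assumes "\<And>F. finite F \<Longrightarrow> F \<subseteq> A \<Longrightarrow> (\<Sum>a\<in>F. ennreal \<bar>h a\<bar>) \<le> B"
  shows "ennreal \<bar>infsum h A\<bar> \<le> B"
proof (cases "h summable_on A")
  case True
  then have abs: "(\<lambda>a. \<bar>h a\<bar>) summable_on A"
    by (rule summable_on_iff_abs_summable_on_real[THEN iffD1, unfolded real_norm_def])
  have "ennreal \<bar>infsum h A\<bar> \<le> ennreal (\<Sum>\<^sub>\<infinity>a\<in>A. \<bar>h a\<bar>)"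
    unfolding real_norm_def[symmetric] by (intro ennreal_leI norm_infsum_bound) (use abs in simp)
  also have "\<dots> = (SUP F\<in>{F. finite F \<and> F \<subseteq> A}. ennreal (\<Sum>a\<in>F. \<bar>h a\<bar>))"
    by (rule infsum_nonneg_is_SUPREMUM_ennreal[OF abs]) simp
  also have "\<dots> \<le> B"
    using assms by (intro SUP_least) (simp add: sum_ennreal)
  finally show ?thesis .
qed (simp add: infsum_not_exists)

lemma sum_moment_term_le_abs_moment:
  assumes "p \<in> quadrant" "finite F"
  shows "(\<Sum>kj\<in>F. ennreal (moment_term \<kappa> p1 p2 p kj)) \<le> abs_moment \<kappa> p1 p2"
proof -
  have "(\<Sum>kj\<in>F. ennreal (moment_term \<kappa> p1 p2 p kj))
      \<le> (\<Sum>\<^sub>\<infinity>kj\<in>UNIV. ennreal (moment_term \<kappa> p1 p2 p kj))"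
    using assms(2) by (subst nonneg_infsum_complete) (auto intro!: SUP_upper)
  also have "\<dots> \<le> abs_moment \<kappa> p1 p2"
    unfolding abs_moment_def by (rule SUP_upper[OF assms(1)])
  finally show ?thesis .
qed


section \<open>The error of the GBS operator\<close>

text \<open>For the cell of side \<open>1 / w\<close> with lower left corner \<open>(k / w, j / w)\<close> and zero lines
  through \<open>(ln x, ln y)\<close> the cell estimate produces the product \<open>(1 + 2 * X) * (1 + 2 * Y)\<close>, whose expansion gives the moment terms of orders
  \<open>(0, 0)\<close>, \<open>(1, 0)\<close>, \<open>(0, 1)\<close> and \<open>(1, 1)\<close>; the moments are taken at the
  dilated point \<open>p\<close> since \<open>ln (x powr w) = w * ln x\<close>.\<close>

lemma kantorovich_gbs_term_deviation:
  assumes f: "f \<in> mellin_B_space"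
    and K: "\<And>p. p \<in> quadrant \<Longrightarrow> \<bar>mellin_B_differential f p\<bar> \<le> K"
    and pos: "x > 0" "y > 0" "w > 0"
  defines "p \<equiv> (x powr w, y powr w)"
  shows "\<bar>kantorovich_term \<kappa> w (gbs_argument f (x, y)) (x, y) (k, j)
       - \<kappa> (exp (- real_of_int k) * x powr w, exp (- real_of_int j) * y powr w) * f (x, y)\<bar>
    \<le> K / (4 * w\<^sup>2) * (moment_term \<kappa> 0 0 p (k, j) + 2 * moment_term \<kappa> 1 0 p (k, j)
        + 2 * moment_term \<kappa> 0 1 p (k, j) + 4 * moment_term \<kappa> 1 1 p (k, j))"
proof -
  define c where "c = \<kappa> (exp (- real_of_int k) * x powr w, exp (- real_of_int j) * y powr w)"
  define G where "G u v = mixed_diff f (exp u, exp v) (x, y)" for u v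
  define I where "I = (LINT u:{k / w..k / w + 1 / w}|lebesgue.
    (LINT v:{j / w..j / w + 1 / w}|lebesgue. f (x, y) - G u v))"
  define X Y where "X = \<bar>real_of_int k - w * ln x\<bar>" and "Y = \<bar>real_of_int j - w * ln y\<bar>"
  have term_eq: "kantorovich_term \<kappa> w (gbs_argument f (x, y)) (x, y) (k, j) = c * w\<^sup>2 * I"
    by (simp add: kantorovich_term_def gbs_argument_def c_def I_def G_def mixed_diff_def
        add_divide_distrib algebra_simps)
  have scale: "1 / w * \<bar>real_of_int n / w - ln z\<bar> + (1 / w)\<^sup>2 / 2
      = (1 + 2 * \<bar>real_of_int n - w * ln z\<bar>) / (2 * w\<^sup>2)" for n z
  proof -
    have "\<bar>real_of_int n / w - ln z\<bar> = \<bar>real_of_int n - w * ln z\<bar> / w"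
      using pos by (simp add: divide_simps abs_divide[symmetric] mult.commute flip: abs_mult_pos)
    then show ?thesis using pos by (simp add: field_simps power2_eq_square)
  qed
  have "\<bar>I - (1 / w)\<^sup>2 * f (x, y)\<bar>
      \<le> K * (1 / w * \<bar>k / w - ln x\<bar> + (1 / w)\<^sup>2 / 2) * (1 / w * \<bar>j / w - ln y\<bar> + (1 / w)\<^sup>2 / 2)"
    unfolding I_def
  proof (rule iterated_integral_mixed_lipschitz)
    show "G (ln x) v = 0" "G u (ln y) = 0" for u v
      using pos by (simp_all add: G_def mixed_diff_def)
    fix u v u' v' :: real
    have "G u v - G u' v - G u v' + G u' v' = mixed_diff f (exp u, exp v) (exp u', exp v')"
      by (simp add: G_def mixed_diff_def)
    then show "\<bar>G u v - G u' v - G u v' + G u' v'\<bar> \<le> K * \<bar>u - u'\<bar> * \<bar>v - v'\<bar>"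
      using mixed_diff_mean_value_bound[OF f K, of "exp u" "exp v" "exp u'" "exp v'"] by simp
  qed (use pos in simp)
  then have dev: "\<bar>I - (1 / w)\<^sup>2 * f (x, y)\<bar> \<le> K * ((1 + 2 * X) / (2 * w\<^sup>2)) * ((1 + 2 * Y) / (2 * w\<^sup>2))"
    unfolding scale X_def Y_def .
  have "c * w\<^sup>2 * I - c * f (x, y) = (c * w\<^sup>2) * (I - (1 / w)\<^sup>2 * f (x, y))"
    using pos by (simp add: field_simps)
  then have "\<bar>c * w\<^sup>2 * I - c * f (x, y)\<bar> = (\<bar>c\<bar> * w\<^sup>2) * \<bar>I - (1 / w)\<^sup>2 * f (x, y)\<bar>"
    by (simp add: abs_mult)
  also have "\<dots> \<le> (\<bar>c\<bar> * w\<^sup>2) * (K * ((1 + 2 * X) / (2 * w\<^sup>2)) * ((1 + 2 * Y) / (2 * w\<^sup>2)))"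
    by (intro mult_left_mono dev) simp
  also have "\<dots> = K / (4 * w\<^sup>2) * (\<bar>c\<bar> + 2 * (\<bar>c\<bar> * X) + 2 * (\<bar>c\<bar> * Y) + 4 * (\<bar>c\<bar> * X * Y))"
    using pos by (simp add: field_simps power2_eq_square)
  finally show ?thesis
    unfolding term_eq c_def[symmetric]
    using pos by (simp add: moment_term_def p_def c_def X_def Y_def ln_powr)
qed

text \<open>The kernel values sum to \<open>1\<close>, so subtracting \<open>f (x, y)\<close> from the operator amounts to
  subtracting the kernel value times \<open>f (x, y)\<close> from each term of the series.\<close>

lemma gbs_error_le_moments_mult_sup_norm:
  assumes \<kappa>: "\<kappa> \<in> kernel_class" and f: "f \<in> mellin_B_space"
    and bdd: "bounded (mellin_B_differential f ` quadrant)"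
    and xy: "(x, y) \<in> quadrant" and w: "w > 0"
    and defd: "gbs_defined \<kappa> w f (x, y)"
  shows "ennreal \<bar>gbs \<kappa> w f (x, y) - f (x, y)\<bar>
    \<le> ennreal (1 / (4 * w\<^sup>2)) * (abs_moment \<kappa> 0 0 + 2 * abs_moment \<kappa> 1 0 + 2 * abs_moment \<kappa> 0 1
        + 4 * abs_moment \<kappa> 1 1) * sup_norm (mellin_B_differential f)"
proof -
  let ?\<theta> = "mellin_B_differential f"
  define p where "p = (x powr w, y powr w)"
  define c where "c = (\<lambda>(k, j). \<kappa> (exp (- real_of_int k) * x powr w, exp (- real_of_int j) * y powr w))"
  define T where "T = kantorovich_term \<kappa> w (gbs_argument f (x, y)) (x, y)"
  define m where "m i l = moment_term \<kappa> i l p" for i l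
  have pos: "x > 0" "y > 0" using xy by (auto simp: quadrant_def)
  then have p: "p \<in> quadrant" by (simp add: p_def quadrant_def)
  obtain L where L: "\<And>q. q \<in> quadrant \<Longrightarrow> \<bar>?\<theta> q\<bar> \<le> L"
    using bdd unfolding bounded_iff by auto
  then have "sup_norm ?\<theta> \<le> ennreal L"
    unfolding sup_norm_def by (intro SUP_least ennreal_leI)
  then have fin: "sup_norm ?\<theta> < \<infinity>" by (auto intro: le_less_trans)
  define K where "K = enn2real (sup_norm ?\<theta>)"
  have K0: "K \<ge> 0" and K_eq: "ennreal K = sup_norm ?\<theta>"
    using fin by (simp_all add: K_def)
  have K: "\<bar>?\<theta> q\<bar> \<le> K" if "q \<in> quadrant" for q
  proof -
    have "ennreal \<bar>?\<theta> q\<bar> \<le> ennreal K"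
      unfolding K_eq sup_norm_def by (rule SUP_upper[OF that])
    then show ?thesis using K0 by (simp add: ennreal_le_iff)
  qed
  have "(c has_sum 1) UNIV"
    using \<kappa> p unfolding kernel_class_def p_def c_def by auto
  then have "((\<lambda>kj. - (c kj * f (x, y))) has_sum - (1 * f (x, y))) UNIV"
    by (intro has_sum_uminusI has_sum_cmult_left)
  moreover have "(T has_sum gbs \<kappa> w f (x, y)) UNIV"
    using defd unfolding T_def gbs_defined_def kantorovich_defined_def gbs_def kantorovich_def
    by (auto intro: has_sum_infsum)
  ultimately have "((\<lambda>kj. T kj + - (c kj * f (x, y))) has_sum
      (gbs \<kappa> w f (x, y) + - (1 * f (x, y)))) UNIV"
    by (rule has_sum_add[rotated])
  then have diff: "gbs \<kappa> w f (x, y) - f (x, y) = (\<Sum>\<^sub>\<infinity>kj. T kj - c kj * f (x, y))"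
    by (simp add: infsumI)
  have m0: "m i l kj \<ge> 0" for i l kj
    by (cases kj) (simp add: m_def moment_term_def p_def)
  have dev: "\<bar>T kj - c kj * f (x, y)\<bar>
      \<le> K / (4 * w\<^sup>2) * (m 0 0 kj + 2 * m 1 0 kj + 2 * m 0 1 kj + 4 * m 1 1 kj)" for kj
    using kantorovich_gbs_term_deviation[OF f K pos w]
    by (cases kj) (simp add: T_def c_def m_def p_def)
  show ?thesis
    unfolding diff
  proof (rule ennreal_abs_infsum_le)
    fix F :: "(int \<times> int) set"
    assume F: "finite F"
    have m: "(\<Sum>kj\<in>F. ennreal (m i l kj)) \<le> abs_moment \<kappa> i l" for i l
      unfolding m_def by (rule sum_moment_term_le_abs_moment[OF p F])
    have "(\<Sum>kj\<in>F. ennreal \<bar>T kj - c kj * f (x, y)\<bar>)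
        \<le> (\<Sum>kj\<in>F. ennreal (K / (4 * w\<^sup>2) * (m 0 0 kj + 2 * m 1 0 kj + 2 * m 0 1 kj + 4 * m 1 1 kj)))"
      by (intro sum_mono ennreal_leI dev)
    also have "\<dots> = (\<Sum>kj\<in>F. ennreal (K / (4 * w\<^sup>2)) * (ennreal (m 0 0 kj)
        + 2 * ennreal (m 1 0 kj) + 2 * ennreal (m 0 1 kj) + 4 * ennreal (m 1 1 kj)))"
      using K0 m0 by (simp only: ennreal_mult ennreal_plus ennreal_numeral add_nonneg_nonneg
          mult_nonneg_nonneg zero_le_numeral divide_nonneg_nonneg zero_le_power2)
    also have "\<dots> = ennreal (K / (4 * w\<^sup>2)) * ((\<Sum>kj\<in>F. ennreal (m 0 0 kj))
        + 2 * (\<Sum>kj\<in>F. ennreal (m 1 0 kj)) + 2 * (\<Sum>kj\<in>F. ennreal (m 0 1 kj))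
        + 4 * (\<Sum>kj\<in>F. ennreal (m 1 1 kj)))"
      by (simp only: sum.distrib sum_distrib_left[symmetric])
    also have "\<dots> \<le> ennreal (K / (4 * w\<^sup>2)) * (abs_moment \<kappa> 0 0 + 2 * abs_moment \<kappa> 1 0
        + 2 * abs_moment \<kappa> 0 1 + 4 * abs_moment \<kappa> 1 1)"
      by (intro mult_left_mono add_mono m) auto
    also have "ennreal (K / (4 * w\<^sup>2)) = ennreal (1 / (4 * w\<^sup>2)) * sup_norm ?\<theta>"
      using K0 by (simp add: K_eq[symmetric] ennreal_mult[symmetric])
    finally show "(\<Sum>kj\<in>F. ennreal \<bar>T kj - c kj * f (x, y)\<bar>)
        \<le> ennreal (1 / (4 * w\<^sup>2)) * (abs_moment \<kappa> 0 0 + 2 * abs_moment \<kappa> 1 0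
          + 2 * abs_moment \<kappa> 0 1 + 4 * abs_moment \<kappa> 1 1) * sup_norm ?\<theta>"
      by (simp only: mult_ac)
  qed
qed

theorem theorem4p2:
  fixes \<kappa> f :: "real \<times> real \<Rightarrow> real" and x y w \<delta>1 \<delta>2 :: real
    and M :: "nat \<Rightarrow> nat \<Rightarrow> ennreal" and E1 E2 E3 E4 N \<omega> :: ennreal
  assumes "\<kappa> \<in> kernel_class"
    and "f \<in> mellin_B_space"
    and "bounded (mellin_B_differential f ` quadrant)"
    and "(x, y) \<in> quadrant" and "w > 0" and "\<delta>1 > 0" and "\<delta>2 > 0"
    and "gbs_defined \<kappa> w f (x, y)"
  defines "M \<equiv> abs_moment \<kappa>"
    and "N \<equiv> sup_norm (mellin_B_differential f)"
    and "\<omega> \<equiv> mixed_modulus (mellin_B_differential f) \<delta>1 \<delta>2"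
    and "E1 \<equiv> ennreal (1 / (4 * w ^ 2)) * (M 0 0 + 2 * M 1 0 + 2 * M 0 1 + 4 * M 1 1)"
    and "E2 \<equiv> ennreal (1 / (6 * w ^ 3)) *
      (M 0 0 + 3 * M 2 0 + 3 * M 1 0 + 2 * M 0 1 + 6 * M 2 1 + 6 * M 1 1)"
    and "E3 \<equiv> ennreal (1 / (6 * w ^ 3)) *
      (M 0 0 + 3 * M 0 2 + 3 * M 0 1 + 2 * M 1 0 + 6 * M 1 2 + 6 * M 1 1)"
    and "E4 \<equiv> ennreal (1 / (9 * w ^ 4)) *
      (M 0 0 + 3 * M 2 0 + 3 * M 0 2 + 3 * M 1 0 + 3 * M 0 1
        + 9 * M 2 2 + 9 * M 1 2 + 9 * M 2 1 + 9 * M 1 1)"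
  shows "ennreal \<bar>gbs \<kappa> w f (x, y) - f (x, y)\<bar> \<le>
    (if \<exists>p1\<le>2. \<exists>p2\<le>2. M p1 p2 = \<infinity> then \<infinity>
     else E1 * (3 * N + \<omega>)
       + (E2 / ennreal \<delta>1 + E3 / ennreal \<delta>2 + E4 / ennreal (\<delta>1 * \<delta>2)) * \<omega>)"
proof (cases "\<exists>p1\<le>2. \<exists>p2\<le>2. M p1 p2 = \<infinity>")
  case False
  have "ennreal \<bar>gbs \<kappa> w f (x, y) - f (x, y)\<bar> \<le> E1 * N"
    unfolding E1_def N_def M_def by (rule gbs_error_le_moments_mult_sup_norm) fact+
  also have "\<dots> \<le> E1 * (3 * N + \<omega>)"
  proof (rule mult_left_mono)
    have "1 * N \<le> 3 * N" by (rule mult_right_mono) simp_all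
    also have "\<dots> \<le> 3 * N + \<omega>" by simp
    finally show "N \<le> 3 * N + \<omega>" by simp
  qed simp
  also have "\<dots> \<le> E1 * (3 * N + \<omega>)
      + (E2 / ennreal \<delta>1 + E3 / ennreal \<delta>2 + E4 / ennreal (\<delta>1 * \<delta>2)) * \<omega>"
    by simp
  finally show ?thesis by (simp only: if_not_P[OF False])
qed simp

end
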